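(* Let $A, B \subseteq \mathbb{N}$. If the symmetric difference $A \triangle B$ is not piecewise syndetic, then $A$ is a set of pointwise recurrence if and only if $B$ is a set of pointwise recurrence. The same is true with "a set of pointwise recurrence" replaced by "dynamically thick", by "dynamically syndetic", and by "dynamically central syndetic".
   Context: $\mathbb{N}$ is the set of positive integers; $A - n = \{m \in \mathbb{N} : m + n \in A\}$. A set $A \subseteq \mathbb{N}$ is thick if for every finite $F \subseteq \mathbb{N}$ there is $n \in \mathbb{N}$ with $F + n \subseteq A$; piecewise syndetic if there is $N \in \mathbb{N}$ such that $A \cup (A-1) \cup \cdots \cup (A-N)$ is thick. A (topological dynamical) system $(X,T)$ is a nonempty compact metric space $X$ together with a continuous map $T : X \to X$. It is minimal if the only nonempty closed $Y \subseteq X$ with $TY \subseteq Y$ is $Y = X$. For $x \in X$ and $U \subseteq X$, $R(x,U) = \{n \in \mathbb{N} : T^n x \in U\}$. A set of positive integers is dynamically syndetic if it contains a set $R(x,U)$ where $(X,T)$ is a minimal system, $x \in X$, and $U \subseteq X$ is nonempty and open; it is dynamically central syndetic if it contains such a set with moreover $x \in U$. A set $A \subseteq \mathbb{N}$ is a set of pointwise recurrence if for all minimal systems $(X,T)$, all $x \in X$, and all open $U \ni x$, there is $n \in A$ with $T^n x \in U$; it is dynamically thick if the same holds for all nonempty open $U \subseteq X$. *)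

theory Defs
  imports "HOL-Analysis.Analysis"
begin

definition pshift :: "nat set \<Rightarrow> nat \<Rightarrow> nat set" where
  "pshift A n = {m. 1 \<le> m \<and> m + n \<in> A}"

definition thick :: "nat set \<Rightarrow> bool" where
  "thick A \<longleftrightarrow> (\<forall>F. finite F \<and> F \<subseteq> {1..} \<longrightarrow> (\<exists>n\<ge>1. (\<lambda>m. m + n) ` F \<subseteq> A))"

definition piecewise_syndetic :: "nat set \<Rightarrow> bool" where
  "piecewise_syndetic A \<longleftrightarrow> (\<exists>N\<ge>1. thick (A \<union> (\<Union>n\<in>{1..N}. pshift A n)))"

definition tds :: "'a set \<Rightarrow> ('a \<Rightarrow> 'a \<Rightarrow> real) \<Rightarrow> ('a \<Rightarrow> 'a) \<Rightarrow> bool" where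
  "tds X d T \<longleftrightarrow>
     Metric_space X d \<and> X \<noteq> {} \<and> compact_space (Metric_space.mtopology X d) \<and>
     continuous_map (Metric_space.mtopology X d) (Metric_space.mtopology X d) T"

definition minimal_tds :: "'a set \<Rightarrow> ('a \<Rightarrow> 'a \<Rightarrow> real) \<Rightarrow> ('a \<Rightarrow> 'a) \<Rightarrow> bool" where
  "minimal_tds X d T \<longleftrightarrow>
     tds X d T \<and>
     (\<forall>Y. closedin (Metric_space.mtopology X d) Y \<and> Y \<noteq> {} \<and> T ` Y \<subseteq> Y \<longrightarrow> Y = X)"

definition return_times :: "('a \<Rightarrow> 'a) \<Rightarrow> 'a \<Rightarrow> 'a set \<Rightarrow> nat set" where
  "return_times T x U = {n. 1 \<le> n \<and> (T ^^ n) x \<in> U}"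

text \<open>
  A definition cannot quantify over all types, so the four notions below let systems range over
  all carriers and all metrics inside the type \<^typ>\<open>nat \<Rightarrow> real\<close> (the metric is arbitrary, not
  the product metric). Nothing is lost: every compact metric space is isometric to one of these,
  via the distances to a dense sequence. The lemmas \<open>pointwise_recurrence_setD\<close>,
  \<open>dynamically_thickD\<close>, \<open>dynamically_syndeticI\<close> and \<open>dynamically_central_syndeticI\<close> at the end
  show that systems on an arbitrary type yield the same notions.
\<close>

definition pointwise_recurrence_set :: "nat set \<Rightarrow> bool" where
  "pointwise_recurrence_set A \<longleftrightarrow>
     (\<forall>(X :: (nat \<Rightarrow> real) set) d T x U.
        minimal_tds X d T \<and> x \<in> X \<and> openin (Metric_space.mtopology X d) U \<and> x \<in> U \<longrightarrow>
        (\<exists>n\<in>A. (T ^^ n) x \<in> U))"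

definition dynamically_thick :: "nat set \<Rightarrow> bool" where
  "dynamically_thick A \<longleftrightarrow>
     (\<forall>(X :: (nat \<Rightarrow> real) set) d T x U.
        minimal_tds X d T \<and> x \<in> X \<and> openin (Metric_space.mtopology X d) U \<and> U \<noteq> {} \<longrightarrow>
        (\<exists>n\<in>A. (T ^^ n) x \<in> U))"

definition dynamically_syndetic :: "nat set \<Rightarrow> bool" where
  "dynamically_syndetic A \<longleftrightarrow>
     (\<exists>(X :: (nat \<Rightarrow> real) set) d T x U.
        minimal_tds X d T \<and> x \<in> X \<and> openin (Metric_space.mtopology X d) U \<and> U \<noteq> {} \<and>
        return_times T x U \<subseteq> A)"

definition dynamically_central_syndetic :: "nat set \<Rightarrow> bool" where
  "dynamically_central_syndetic A \<longleftrightarrow>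
     (\<exists>(X :: (nat \<Rightarrow> real) set) d T x U.
        minimal_tds X d T \<and> x \<in> X \<and> openin (Metric_space.mtopology X d) U \<and> x \<in> U \<and>
        return_times T x U \<subseteq> A)"

lemma compact_metric_inj_nat_real:
  assumes "Metric_space X d" and "compact_space (Metric_space.mtopology X d)"
  shows "\<exists>f :: 'a \<Rightarrow> nat \<Rightarrow> real. inj_on f X"
proof -
  interpret Metric_space X d by fact
  have tb: "mtotally_bounded X"
    using assms(2) compact_space_eq_mcomplete_mtotally_bounded by blast
  have "\<exists>K. finite K \<and> K \<subseteq> X \<and> X \<subseteq> (\<Union>x\<in>K. mball x (inverse (real (Suc n))))" for n
    using tb unfolding mtotally_bounded_def by (simp del: of_nat_Suc)
  then obtain K where K: "\<And>n. finite (K n)" "\<And>n. K n \<subseteq> X"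
      "\<And>n. X \<subseteq> (\<Union>x\<in>K n. mball x (inverse (real (Suc n))))"
    by metis
  define D where "D = (\<Union>n. K n)"
  have D: "countable D" "D \<subseteq> X"
    using K by (auto simp: D_def intro: countable_finite)
  have inj: "x = y" if "x \<in> X" "y \<in> X" and eq: "\<And>z. z \<in> D \<Longrightarrow> d x z = d y z" for x y
  proof (rule ccontr)
    assume "x \<noteq> y"
    then have "d x y / 2 > 0" using that by simp
    then obtain n where n: "inverse (real (Suc n)) < d x y / 2"
      using reals_Archimedean by blast
    obtain z where z: "z \<in> K n" "x \<in> mball z (inverse (real (Suc n)))"
      using K(3) \<open>x \<in> X\<close> by blast
    then have zX: "z \<in> X" and "z \<in> D" using K(2) by (auto simp: D_def)
    have "d x z < inverse (real (Suc n))" using z(2) by (simp add: commute)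
    moreover have "d x y \<le> d x z + d y z" using triangle' that zX by blast
    ultimately show False using eq[OF \<open>z \<in> D\<close>] n by linarith
  qed
  have "inj_on (\<lambda>x n. d x (from_nat_into D n)) X"
  proof (rule inj_onI)
    fix x y assume xy: "x \<in> X" "y \<in> X"
      and eq: "(\<lambda>n. d x (from_nat_into D n)) = (\<lambda>n. d y (from_nat_into D n))"
    show "x = y"
    proof (rule inj[OF xy])
      fix z assume "z \<in> D"
      then obtain n where "z = from_nat_into D n"
        using from_nat_into_surj[OF D(1)] by metis
      then show "d x z = d y z" using fun_cong[OF eq] by simp
    qed
  qed
  then show ?thesis by blast
qed

lemma minimal_tds_transfer:
  assumes min: "minimal_tds X d T"
  obtains f :: "'a \<Rightarrow> nat \<Rightarrow> real" and d' T'
  where "inj_on f X" and "minimal_tds (f ` X) d' T'"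
    and "\<And>U. openin (Metric_space.mtopology X d) U \<Longrightarrow>
               openin (Metric_space.mtopology (f ` X) d') (f ` U)"
    and "\<And>x U n. x \<in> X \<Longrightarrow> U \<subseteq> X \<Longrightarrow> (T' ^^ n) (f x) \<in> f ` U \<longleftrightarrow> (T ^^ n) x \<in> U"
proof -
  have ms: "Metric_space X d" and ne: "X \<noteq> {}"
    and cpt: "compact_space (Metric_space.mtopology X d)"
    and cont: "continuous_map (Metric_space.mtopology X d) (Metric_space.mtopology X d) T"
    and mn: "\<And>Y. closedin (Metric_space.mtopology X d) Y \<Longrightarrow> Y \<noteq> {} \<Longrightarrow> T ` Y \<subseteq> Y \<Longrightarrow> Y = X"
    using min unfolding minimal_tds_def tds_def by auto
  interpret M1: Metric_space X d by fact
  obtain f :: "'a \<Rightarrow> nat \<Rightarrow> real" where inj: "inj_on f X"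
    using compact_metric_inj_nat_real[OF ms cpt] by blast
  define g where "g = inv_into X f"
  have gf [simp]: "g (f x) = x" if "x \<in> X" for x
    using inj that by (simp add: g_def)
  define d' where "d' = (\<lambda>u v. d (g u) (g v))"
  define T' where "T' = (\<lambda>u. f (T (g u)))"
  interpret M2: Metric_space "f ` X" d'
    by unfold_locales (auto simp: d'_def M1.commute M1.triangle inj_on_eq_iff[OF inj])
  interpret M12: Metric_space12 X d "f ` X" d' ..
  interpret M21: Metric_space12 "f ` X" d' X d ..
  have hf: "homeomorphic_map M1.mtopology M2.mtopology f"
    by (rule M12.isometry_imp_homeomorphic_map) (auto simp: d'_def)
  have hg: "homeomorphic_map M2.mtopology M1.mtopology g"
    by (rule M21.isometry_imp_homeomorphic_map) (auto simp: d'_def image_image)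
  have cpt': "compact_space M2.mtopology"
    using cpt hf homeomorphic_compact_space homeomorphic_map_imp_homeomorphic_space by blast
  have cont': "continuous_map M2.mtopology M2.mtopology T'"
    using continuous_map_compose[OF homeomorphic_imp_continuous_map[OF hg]
        continuous_map_compose[OF cont homeomorphic_imp_continuous_map[OF hf]]]
    by (simp add: T'_def o_def)
  have TX: "T x \<in> X" if "x \<in> X" for x
    using continuous_map_image_subset_topspace[OF cont] that by auto
  have mn': "Y = f ` X" if Y: "closedin M2.mtopology Y" "Y \<noteq> {}" "T' ` Y \<subseteq> Y" for Y
  proof -
    have sub: "Y \<subseteq> f ` X" using closedin_subset[OF Y(1)] by simp
    then have fgY: "f ` (g ` Y) = Y" by (force simp: image_image)
    have "closedin M1.mtopology (g ` Y)"
      using homeomorphic_map_closedness_eq[OF hg] Y(1) by blast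
    moreover have "T ` (g ` Y) \<subseteq> g ` Y"
    proof clarify
      fix y assume y: "y \<in> Y"
      then have "T' y \<in> Y" using Y(3) by blast
      moreover have "g y \<in> X" using y sub by auto
      then have "g (T' y) = T (g y)" by (simp add: T'_def TX)
      ultimately show "T (g y) \<in> g ` Y" by (metis imageI)
    qed
    ultimately have "g ` Y = X" using mn Y(2) by blast
    then show ?thesis using fgY by simp
  qed
  have iter: "(T' ^^ n) (f x) = f ((T ^^ n) x) \<and> (T ^^ n) x \<in> X" if "x \<in> X" for x n
    by (induction n) (use that in \<open>auto simp: T'_def TX\<close>)
  show ?thesis
  proof (rule that[OF inj])
    show "minimal_tds (f ` X) d' T'"
      unfolding minimal_tds_def tds_def
      using M2.Metric_space_axioms ne cpt' cont' mn' by blast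
    show "openin M2.mtopology (f ` U)" if "openin M1.mtopology U" for U
      using hf that homeomorphic_map_openness_eq by blast
    show "(T' ^^ n) (f x) \<in> f ` U \<longleftrightarrow> (T ^^ n) x \<in> U" if "x \<in> X" "U \<subseteq> X" for x U n
      using iter[OF that(1), of n] that(2) inj_on_image_mem_iff[OF inj] by metis
  qed
qed

lemma openin_mtopology_subset:
  "minimal_tds X d T \<Longrightarrow> openin (Metric_space.mtopology X d) U \<Longrightarrow> U \<subseteq> X"
  using Metric_space.topspace_mtopology openin_subset
  unfolding minimal_tds_def tds_def by metis

lemma pointwise_recurrence_setD:
  assumes "pointwise_recurrence_set A" "minimal_tds X d T" "x \<in> X"
    and "openin (Metric_space.mtopology X d) U" "x \<in> U"
  shows "\<exists>n\<in>A. (T ^^ n) x \<in> U"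
proof -
  obtain f :: "'a \<Rightarrow> nat \<Rightarrow> real" and d' T' where f: "minimal_tds (f ` X) d' T'"
      "openin (Metric_space.mtopology (f ` X) d') (f ` U)"
      "\<And>n. (T' ^^ n) (f x) \<in> f ` U \<longleftrightarrow> (T ^^ n) x \<in> U"
    using minimal_tds_transfer[OF assms(2)] assms openin_mtopology_subset by metis
  then have "\<exists>n\<in>A. (T' ^^ n) (f x) \<in> f ` U"
    using assms unfolding pointwise_recurrence_set_def by blast
  then show ?thesis using f(3) by blast
qed

lemma dynamically_thickD:
  assumes "dynamically_thick A" "minimal_tds X d T" "x \<in> X"
    and "openin (Metric_space.mtopology X d) U" "U \<noteq> {}"
  shows "\<exists>n\<in>A. (T ^^ n) x \<in> U"
proof -
  obtain f :: "'a \<Rightarrow> nat \<Rightarrow> real" and d' T' where f: "minimal_tds (f ` X) d' T'"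
      "openin (Metric_space.mtopology (f ` X) d') (f ` U)"
      "\<And>n. (T' ^^ n) (f x) \<in> f ` U \<longleftrightarrow> (T ^^ n) x \<in> U"
    using minimal_tds_transfer[OF assms(2)] assms openin_mtopology_subset by metis
  moreover have "f x \<in> f ` X" "f ` U \<noteq> {}" using assms by auto
  ultimately have "\<exists>n\<in>A. (T' ^^ n) (f x) \<in> f ` U"
    using assms(1) unfolding dynamically_thick_def by blast
  then show ?thesis using f(3) by blast
qed

lemma dynamically_syndeticI:
  assumes "minimal_tds X d T" "x \<in> X"
    and "openin (Metric_space.mtopology X d) U" "U \<noteq> {}" "return_times T x U \<subseteq> A"
  shows "dynamically_syndetic A"
proof -
  obtain f :: "'a \<Rightarrow> nat \<Rightarrow> real" and d' T' where f: "minimal_tds (f ` X) d' T'"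
      "openin (Metric_space.mtopology (f ` X) d') (f ` U)"
      "\<And>n. (T' ^^ n) (f x) \<in> f ` U \<longleftrightarrow> (T ^^ n) x \<in> U"
    using minimal_tds_transfer[OF assms(1)] assms openin_mtopology_subset by metis
  have "return_times T' (f x) (f ` U) \<subseteq> A"
    using assms(5) by (simp add: return_times_def f(3))
  moreover have "f x \<in> f ` X" "f ` U \<noteq> {}" using assms by auto
  ultimately show ?thesis
    using f(1,2) unfolding dynamically_syndetic_def by blast
qed

lemma dynamically_central_syndeticI:
  assumes "minimal_tds X d T" "x \<in> X"
    and "openin (Metric_space.mtopology X d) U" "x \<in> U" "return_times T x U \<subseteq> A"
  shows "dynamically_central_syndetic A"
proof -
  obtain f :: "'a \<Rightarrow> nat \<Rightarrow> real" and d' T' where f: "minimal_tds (f ` X) d' T'"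
      "openin (Metric_space.mtopology (f ` X) d') (f ` U)"
      "\<And>n. (T' ^^ n) (f x) \<in> f ` U \<longleftrightarrow> (T ^^ n) x \<in> U"
    using minimal_tds_transfer[OF assms(1)] assms openin_mtopology_subset by metis
  have "return_times T' (f x) (f ` U) \<subseteq> A"
    using assms(5) by (simp add: return_times_def f(3))
  moreover have "f x \<in> f ` X" "f x \<in> f ` U" using assms by auto
  ultimately show ?thesis
    using f(1,2) unfolding dynamically_central_syndetic_def by blast
qed

end

theory Submission
  imports Defs
begin

text \<open>
  Removing a set \<open>E\<close> that is not piecewise syndetic from a dynamically (central) syndetic set leaves a
  dynamically (central) syndetic set. This gives the claim for the two syndetic notions, and the
  claim for pointwise recurrence and for dynamical thickness follows by complementation: \<open>A\<close> is a
  set of pointwise recurrence iff its complement is not dynamically central syndetic, and dynamically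
  thick iff its complement is not dynamically syndetic.

  The complement of \<open>E\<close> contains windows of any prescribed length with bounded gaps. So if \<open>x\<close> is a
  point of a minimal system and \<open>U\<close> a neighbourhood of \<open>x\<close>, then \<open>C = R(x, U) - E\<close> is still rich in the
  following sense: for every finite \<open>V \<subseteq> C \<union> {0}\<close> the set of \<open>n\<close> with \<open>n + V \<subseteq> C\<close> has bounded gaps
  (\<open>dynamically_central_syndetic_diff\<close>). The heart of the proof is that any such \<open>C\<close> is dynamically
  central syndetic (\<open>dynamically_central_syndetic_if_syndetic_translates\<close>). It suffices to find
  \<open>B \<subseteq> C \<union> {0}\<close> with \<open>0 \<in> B\<close> whose indicator sequence is uniformly recurrent: the orbit closure of that
  sequence under the shift is then minimal, and its returns to the cylinder ``the first symbol is 1''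
  are the positive elements of \<open>B\<close>.

  The set \<open>B\<close> is the limit of finite words \<open>W\<^sub>0, W\<^sub>1, \<dots>\<close>, each a prefix of the next. To pass from one
  word to the next, take a second copy of \<open>W\<^sub>k\<close>, at a position \<open>t\<close> with \<open>t + W\<^sub>k \<subseteq> C\<close>, and fill the space
  in between hierarchically: with copies of \<open>W\<^sub>k\<close> as densely as the gaps of \<open>{t. t + W\<^sub>k \<subseteq> C}\<close>
  allow, the space between those with copies of \<open>W\<^sub>k\<^sub>-\<^sub>1\<close>, and so on. The difficulty is that the bound
  on the gaps between copies of a fixed \<open>W\<^sub>j\<close> must not grow with \<open>k\<close>. It does not, because every later
  word begins and ends with \<open>W\<^sub>j\<close>, so that putting words and filled spaces side by side creates no
  longer gap than those around a single copy of \<open>W\<^sub>j\<close>.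

  For dynamically syndetic sets, where \<open>x \<in> U\<close> may fail, replace \<open>x\<close> by \<open>T\<^sup>n x\<close> for a return time
  \<open>n \<notin> E\<close> and translate the resulting dynamically central syndetic set back by \<open>n\<close>
  (\<open>dynamically_syndetic_shift\<close>).
\<close>

section \<open>Occurrences of a word in a set\<close>

text \<open>
  A pair \<open>V\<close>, \<open>M\<close> stands for the word of length \<open>M\<close> over two letters that marks the elements of \<open>V\<close>
  below \<open>M\<close>.
\<close>

definition occurs :: "nat set \<Rightarrow> nat \<Rightarrow> nat set \<Rightarrow> nat \<Rightarrow> bool" where
  "occurs V M D s \<longleftrightarrow> (\<forall>i<M. s + i \<in> D \<longleftrightarrow> i \<in> V)"

text \<open>
  The bound \<open>b\<close> is the end of the region under consideration. A copy that extends beyond \<open>b\<close> does not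
  count, so that the property persists when \<open>D\<close> is extended to the right (\<open>hits_cong\<close>).
\<close>

definition hits :: "nat set \<Rightarrow> nat \<Rightarrow> nat set \<Rightarrow> nat \<Rightarrow> nat \<Rightarrow> nat \<Rightarrow> bool" where
  "hits V M D b p r \<longleftrightarrow> (\<exists>s. p \<le> s \<and> s < p + r \<and> s + M \<le> b \<and> occurs V M D s)"

lemma occurs_trans:
  assumes "occurs V M W s" "occurs W N D t" "s + M \<le> N"
  shows "occurs V M D (t + s)"
  using assms unfolding occurs_def by (simp add: add.assoc)

lemma hits_trans:
  assumes "hits V M W N p r" "occurs W N D t" "t + N \<le> b"
  shows "hits V M D b (t + p) r"
proof -
  obtain s where "p \<le> s" "s < p + r" "s + M \<le> N" "occurs V M W s"
    using assms(1) unfolding hits_def by blast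
  then show ?thesis
    unfolding hits_def using assms(2,3) occurs_trans[of V M W s N D t]
    by (intro exI[of _ "t + s"]) auto
qed

lemma hits_mono:
  "hits V M D b p r \<Longrightarrow> p' \<le> p \<Longrightarrow> p + r \<le> p' + r' \<Longrightarrow> b \<le> b' \<Longrightarrow> hits V M D b' p' r'"
  unfolding hits_def by (meson le_trans less_le_trans)

lemma hits_cong:
  assumes "hits V M D b p r" "D \<inter> {a..<b} = D' \<inter> {a..<b}" "a \<le> p"
  shows "hits V M D' b p r"
proof -
  obtain s where s: "p \<le> s" "s < p + r" "s + M \<le> b" "occurs V M D s"
    using assms(1) unfolding hits_def by blast
  have "occurs V M D' s"
    unfolding occurs_def
  proof (intro allI impI)
    fix i assume "i < M"
    then have "s + i \<in> {a..<b}" using s assms(3) by auto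
    then have "s + i \<in> D' \<longleftrightarrow> s + i \<in> D" using assms(2) by blast
    then show "s + i \<in> D' \<longleftrightarrow> i \<in> V" using s(4) \<open>i < M\<close> unfolding occurs_def by blast
  qed
  then show ?thesis using s unfolding hits_def by blast
qed

section \<open>Hierarchical tilings\<close>

text \<open>
  The number \<open>L V\<close> bounds the gaps of \<open>{n. n + V \<subseteq> C}\<close>. Making it a function of \<open>V\<close> fixes, once and
  for all, the density with which each word has to recur.
\<close>

locale tiling =
  fixes C :: "nat set" and L :: "nat set \<Rightarrow> nat"
  assumes gap: "\<And>V a. finite V \<Longrightarrow> V \<subseteq> insert 0 C \<Longrightarrow>
                  \<exists>n. a \<le> n \<and> n < a + L V \<and> (+) n ` V \<subseteq> C"
begin

text \<open>
  The second alternative allows a search for \<open>V\<close> to run into the end \<open>b\<close> of the region, for what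
  follows \<open>b\<close> will be a word that starts with a copy of \<open>V\<close>.
\<close>

definition soon :: "nat set \<Rightarrow> nat \<Rightarrow> nat set \<Rightarrow> nat \<Rightarrow> nat \<Rightarrow> nat \<Rightarrow> bool" where
  "soon V M D b p r \<longleftrightarrow> hits V M D b p r \<or> b < p + r"

text \<open>
  The filling \<open>D\<close> of \<open>{a..<b}\<close> must meet two different bounds for each word of \<open>\<Gamma>\<close>. The stronger one
  holds at the left end \<open>a\<close>. It pays for the loss of up to \<open>M\<close> that occurs when the search starts in
  the last \<open>M\<close> places of a word to the left of \<open>a\<close>. With a single bound, this loss would add up over
  the levels of the hierarchy.
\<close>

definition fill :: "(nat set \<times> nat) set \<Rightarrow> nat \<Rightarrow> nat \<Rightarrow> nat set \<Rightarrow> bool" where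
  "fill \<Gamma> a b D \<longleftrightarrow> D \<subseteq> C \<inter> {a..<b} \<and>
     (\<forall>(V, M)\<in>\<Gamma>. soon V M D b a (L V + M) \<and>
        (\<forall>p. a \<le> p \<and> p \<le> b \<longrightarrow> soon V M D b p (L V + 2 * M)))"

text \<open>
  Taking \<open>p = N - M\<close> shows that \<open>W\<close> also ends with a copy of \<open>V\<close>.
\<close>

definition recurs :: "nat set \<Rightarrow> nat \<Rightarrow> nat set \<Rightarrow> nat \<Rightarrow> bool" where
  "recurs V M W N \<longleftrightarrow> 0 < M \<and> M \<le> N \<and> occurs V M W 0 \<and>
     (\<forall>p. p + M \<le> N \<longrightarrow> hits V M W N p (L V + 2 * M))"

definition word :: "(nat set \<times> nat) set \<Rightarrow> nat set \<Rightarrow> nat \<Rightarrow> bool" where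
  "word \<Gamma> W N \<longleftrightarrow> 0 < N \<and> 0 \<in> W \<and> W \<subseteq> {..<N} \<and> W \<subseteq> insert 0 C \<and> (\<forall>(V, M)\<in>\<Gamma>. recurs V M W N)"

lemma recurs_self: "0 < N \<Longrightarrow> recurs W N W N"
  unfolding recurs_def hits_def by (auto simp: occurs_def)

lemma word_insert_self: "word \<Gamma> W N \<Longrightarrow> word (insert (W, N) \<Gamma>) W N"
  unfolding word_def using recurs_self by auto

lemma occurs_tile:
  assumes "W \<subseteq> {..<N}" "D \<inter> {t..<t + N} = (+) t ` W"
  shows "occurs W N D t"
  unfolding occurs_def
proof (intro allI impI)
  fix i assume "i < N"
  then have "t + i \<in> D \<longleftrightarrow> t + i \<in> D \<inter> {t..<t + N}" by simp
  also have "\<dots> \<longleftrightarrow> i \<in> W" unfolding assms(2) by auto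
  finally show "t + i \<in> D \<longleftrightarrow> i \<in> W" .
qed

lemma soon_cong:
  assumes "soon V M D b p r" "D \<inter> {a..<b} = D' \<inter> {a..<b}" "a \<le> p"
  shows "soon V M D' b p r"
  using assms hits_cong unfolding soon_def by blast

text \<open>
  A search that reaches the end of its region succeeds if a word starting with \<open>V\<close> follows.
\<close>

lemma soon_before_tile:
  assumes "soon V M D t p r" "recurs V M W N" "occurs W N D t" "p \<le> t" "t + N \<le> b"
  shows "hits V M D b p r"
proof (cases "hits V M D t p r")
  case True
  then show ?thesis using hits_mono assms(5) by (metis add_leD1 le_refl)
next
  case False
  then have "t < p + r" using assms(1) unfolding soon_def by blast
  moreover have "occurs V M D t"
    using occurs_trans[of V M W 0 N D t] assms(2,3) unfolding recurs_def by simp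
  moreover have "t + M \<le> b" using assms(2,5) unfolding recurs_def by linarith
  ultimately show ?thesis using assms(4) unfolding hits_def by blast
qed

text \<open>
  A search that starts inside a word \<open>W\<close> succeeds within \<open>W\<close>, unless it starts in the last \<open>M\<close> places.
  In that case it continues after \<open>W\<close> with the stronger bound, and \<open>M + (L V + M) = L V + 2 * M\<close>.
\<close>

lemma soon_in_tile:
  assumes "recurs V M W N" "occurs W N D t" "t \<le> p" "p < t + N" "t + N \<le> b"
    and "soon V M D b (t + N) (L V + M)"
  shows "soon V M D b p (L V + 2 * M)"
proof (cases "p - t + M \<le> N")
  case True
  then have "hits V M W N (p - t) (L V + 2 * M)" using assms(1) unfolding recurs_def by blast
  then have "hits V M D b (t + (p - t)) (L V + 2 * M)" using hits_trans assms(2,5) by blast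
  then show ?thesis using assms(3) unfolding soon_def by simp
next
  case False
  then show ?thesis
    using assms(3,4,6) hits_mono[of V M D b "t + N" "L V + M" p "L V + 2 * M" b]
    unfolding soon_def by auto
qed

text \<open>
  A space too short for another copy of \<open>W\<close> meets the bounds for \<open>W\<close> vacuously: every search runs
  into the right end.
\<close>

lemma fill_insert_short:
  assumes "fill \<Gamma> a b D" "b < a + L W + N"
  shows "fill (insert (W, N) \<Gamma>) a b D"
  using assms unfolding fill_def soon_def by auto

text \<open>
  The bounds for the composite space are literally the same as for its parts, which is what keeps the
  gaps of a word bounded throughout the hierarchy.
\<close>

lemma fill_concat:
  assumes D1: "fill \<Gamma> a t D1" and W: "word \<Gamma> W N" and tC: "(+) t ` W \<subseteq> C"
    and D2: "fill \<Gamma> (t + N) b D2" and le: "a \<le> t" "t + N \<le> b"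
  shows "fill \<Gamma> a b (D1 \<union> (+) t ` W \<union> D2)" (is "fill _ _ _ ?D")
proof -
  have WN: "W \<subseteq> {..<N}" using W unfolding word_def by blast
  have sub: "D1 \<subseteq> {a..<t}" "(+) t ` W \<subseteq> {t..<t + N}" "D2 \<subseteq> {t + N..<b}"
    using D1 D2 WN unfolding fill_def by auto
  have "?D \<inter> {t..<t + N} = (+) t ` W" using sub by fastforce
  then have occ: "occurs W N ?D t" using occurs_tile[OF WN] by blast
  have e1: "D1 \<inter> {a..<t} = ?D \<inter> {a..<t}" using sub by fastforce
  have e2: "D2 \<inter> {t + N..<b} = ?D \<inter> {t + N..<b}" using sub by fastforce
  have main: "soon V M ?D b a (L V + M) \<and> (\<forall>p. a \<le> p \<and> p \<le> b \<longrightarrow> soon V M ?D b p (L V + 2 * M))"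
    if VM: "(V, M) \<in> \<Gamma>" for V M
  proof -
    have rec: "recurs V M W N" using W VM unfolding word_def by blast
    have l: "soon V M ?D t a (L V + M)" "\<And>p. a \<le> p \<Longrightarrow> p \<le> t \<Longrightarrow> soon V M ?D t p (L V + 2 * M)"
      using D1 VM soon_cong[OF _ e1] unfolding fill_def by blast+
    have r: "soon V M ?D b (t + N) (L V + M)"
        "\<And>p. t + N \<le> p \<Longrightarrow> p \<le> b \<Longrightarrow> soon V M ?D b p (L V + 2 * M)"
      using D2 VM soon_cong[OF _ e2] unfolding fill_def by blast+
    have "soon V M ?D b p (L V + 2 * M)" if p: "a \<le> p" "p \<le> b" for p
    proof (cases "p \<le> t")
      case True
      then show ?thesis
        using soon_before_tile[OF l(2) rec occ] p le unfolding soon_def by blast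
    next
      case False
      then show ?thesis
        using soon_in_tile[OF rec occ _ _ le(2) r(1)] r(2) p by (meson nat_le_linear not_le)
    qed
    then show ?thesis
      using soon_before_tile[OF l(1) rec occ] le unfolding soon_def by blast
  qed
  moreover have "?D \<subseteq> C \<inter> {a..<b}"
  proof -
    have "D1 \<subseteq> C" "D2 \<subseteq> C" using D1 D2 unfolding fill_def by blast+
    moreover have "?D \<subseteq> {a..<b}" using sub le by fastforce
    ultimately show ?thesis using tC by blast
  qed
  ultimately show ?thesis unfolding fill_def by blast
qed

definition fillable :: "(nat set \<times> nat) set \<Rightarrow> bool" where
  "fillable \<Gamma> \<longleftrightarrow> (\<forall>a b. a \<le> b \<longrightarrow> (\<exists>D. fill \<Gamma> a b D))"

text \<open>
  Copies of \<open>W\<close> are placed greedily from the left, each within \<open>L W\<close> of the end of the previous one,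
  and the spaces in between are filled with the shorter words.
\<close>

lemma fillable_insert:
  assumes fl: "fillable \<Gamma>" and W: "word \<Gamma> W N"
  shows "fillable (insert (W, N) \<Gamma>)"
proof -
  have "\<exists>D. fill (insert (W, N) \<Gamma>) a b D" if "a \<le> b" for a b
    using that
  proof (induction "b - a" arbitrary: a rule: less_induct)
    case less
    show ?case
    proof (cases "b < a + L W + N")
      case True
      then show ?thesis using fl less.prems fill_insert_short unfolding fillable_def by blast
    next
      case False
      have fin: "finite W" and WC: "W \<subseteq> insert 0 C" and N: "0 < N"
        using W finite_subset unfolding word_def by auto
      obtain t where t: "a \<le> t" "t < a + L W" "(+) t ` W \<subseteq> C"
        using gap[OF fin WC] by blast
      have tb: "t + N \<le> b" using t False by linarith
      obtain D1 where "fill \<Gamma> a t D1" using fl t(1) unfolding fillable_def by blast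
      then have D1: "fill (insert (W, N) \<Gamma>) a t D1"
        using fill_insert_short t by simp
      have "b - (t + N) < b - a" using t(1) tb N by linarith
      then obtain D2 where D2: "fill (insert (W, N) \<Gamma>) (t + N) b D2"
        using less.hyps tb by blast
      show ?thesis
        using fill_concat[OF D1 word_insert_self[OF W] t(3) D2 t(1) tb] by blast
    qed
  qed
  then show ?thesis unfolding fillable_def by blast
qed

text \<open>
  The new word consists of \<open>W\<close>, a filled space and a second copy of \<open>W\<close>. This makes it begin and
  end with \<open>W\<close>, and hence with every word that \<open>W\<close> begins and ends with.
\<close>

lemma word_extend:
  assumes W: "word \<Gamma> W N" and fl: "fillable \<Gamma>"
  obtains W' N' where "word \<Gamma> W' N'" "N < N'" "W' \<inter> {..<N} = W"
proof -
  have fin: "finite W" and WC: "W \<subseteq> insert 0 C" and N: "0 < N" and W0: "0 \<in> W" and WN: "W \<subseteq> {..<N}"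
    using W finite_subset unfolding word_def by auto
  obtain t where t: "N \<le> t" "(+) t ` W \<subseteq> C" using gap[OF fin WC] by blast
  obtain D where D: "fill \<Gamma> N t D" using fl t(1) unfolding fillable_def by blast
  define W' where "W' = W \<union> D \<union> (+) t ` W"
  have sub: "D \<subseteq> {N..<t}" "(+) t ` W \<subseteq> {t..<t + N}" "D \<subseteq> C"
    using D WN unfolding fill_def by auto
  have WW: "W' \<inter> {..<N} = W" using sub WN t(1) unfolding W'_def by fastforce
  have occ0: "occurs W N W' 0"
    using occurs_tile[OF WN, of W' 0] WW by (simp add: lessThan_atLeast0)
  have "W' \<inter> {t..<t + N} = (+) t ` W" using sub WN t(1) unfolding W'_def by fastforce
  then have occt: "occurs W N W' t" using occurs_tile[OF WN] by blast
  have e: "D \<inter> {N..<t} = W' \<inter> {N..<t}" using sub WN unfolding W'_def by fastforce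
  have "recurs V M W' (t + N)" if VM: "(V, M) \<in> \<Gamma>" for V M
  proof -
    have rec: "recurs V M W N" using W VM unfolding word_def by blast
    have f: "soon V M W' t N (L V + M)" "\<And>p. N \<le> p \<Longrightarrow> p \<le> t \<Longrightarrow> soon V M W' t p (L V + 2 * M)"
      using D VM soon_cong[OF _ e] unfolding fill_def by blast+
    have "hits V M W' (t + N) p (L V + 2 * M)" if p: "p + M \<le> t + N" for p
    proof (cases "p \<le> t")
      case True
      have "soon V M W' t p (L V + 2 * M)"
      proof (cases "p < N")
        case True
        then show ?thesis using soon_in_tile[OF rec occ0, of p t] f(1) t(1) by simp
      next
        case False
        then show ?thesis using f(2) True by simp
      qed
      then show ?thesis using soon_before_tile[OF _ rec occt True] by blast
    next
      case False
      then have "hits V M W N (p - t) (L V + 2 * M)"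
        using rec p unfolding recurs_def by simp
      then show ?thesis using hits_trans[OF _ occt, of V M "p - t"] False by simp
    qed
    moreover have "occurs V M W' 0"
      using occurs_trans[of V M W 0 N W' 0] rec occ0 unfolding recurs_def by simp
    ultimately show ?thesis using rec unfolding recurs_def by simp
  qed
  moreover have "W' \<subseteq> {..<t + N}" "W' \<subseteq> insert 0 C" "0 \<in> W'"
    using sub WN WC t W0 unfolding W'_def by force+
  ultimately have "word \<Gamma> W' (t + N)" using N unfolding word_def by auto
  then show ?thesis using that WW N t(1) by simp
qed

text \<open>
  The prefix of \<open>B\<close> of length \<open>k\<close> is a prefix of the \<open>k\<close>-th word, whose gaps in all later words obey
  one and the same bound, and these exhaust \<open>B\<close>.
\<close>

theorem uniformly_recurrent_subset:
  obtains B where "0 \<in> B" "B \<subseteq> insert 0 C"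
    and "\<And>k. \<exists>G. \<forall>p. \<exists>s. p \<le> s \<and> s < p + G \<and> occurs B k B s"
proof -
  \<comment> \<open>A state of the construction holds the words built so far and singles out the last one.\<close>
  define P where "P = (\<lambda>(n::nat) (\<Gamma>, W, N). word \<Gamma> W N \<and> (W, N) \<in> \<Gamma> \<and> fillable \<Gamma>)"
  define Q where "Q = (\<lambda>(n::nat) (\<Gamma> :: (nat set \<times> nat) set, W, N :: nat) (\<Gamma>', W', N').
     \<Gamma> \<subseteq> \<Gamma>' \<and> N < N' \<and> (W' :: nat set) \<inter> {..<N} = (W :: nat set))"
  have "\<exists>f. \<forall>n. P n (f n) \<and> Q n (f n) (f (Suc n))"
  proof (rule dependent_nat_choice)
    have "word {} {0} 1" by (simp add: word_def)
    moreover have "fillable {}" by (auto simp: fillable_def fill_def)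
    ultimately have "P 0 ({({0}, 1)}, {0}, 1)"
      unfolding P_def using fillable_insert[of "{}" "{0}" 1] word_insert_self[of "{}" "{0}" 1]
      by simp
    then show "\<exists>x. P 0 x" by blast
  next
    fix x n assume x: "P n x"
    obtain \<Gamma> W N where [simp]: "x = (\<Gamma>, W, N)" by (cases x)
    have "word \<Gamma> W N" "fillable \<Gamma>" using x by (auto simp: P_def)
    then obtain W' N' where W': "word \<Gamma> W' N'" "N < N'" "W' \<inter> {..<N} = W"
      using word_extend by blast
    then have "P (Suc n) (insert (W', N') \<Gamma>, W', N')" "Q n x (insert (W', N') \<Gamma>, W', N')"
      using fillable_insert[OF \<open>fillable \<Gamma>\<close>] word_insert_self by (auto simp: P_def Q_def)
    then show "\<exists>y. P (Suc n) y \<and> Q n x y" by blast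
  qed
  then obtain f where f: "\<And>n. P n (f n)" "\<And>n. Q n (f n) (f (Suc n))" by blast
  define \<Gamma> where "\<Gamma> n = fst (f n)" for n
  define W where "W n = fst (snd (f n))" for n
  define N where "N n = snd (snd (f n))" for n
  have fe: "f n = (\<Gamma> n, W n, N n)" for n by (simp add: \<Gamma>_def W_def N_def)
  have wd: "word (\<Gamma> n) (W n) (N n)" and mem: "(W n, N n) \<in> \<Gamma> n" for n
    using f(1)[of n] by (auto simp: P_def fe)
  have \<Gamma>S: "\<Gamma> n \<subseteq> \<Gamma> (Suc n)" and NS: "N n < N (Suc n)" and WS: "W (Suc n) \<inter> {..<N n} = W n" for n
    using f(2)[of n] by (auto simp: Q_def fe)
  have \<Gamma>m: "\<Gamma> m \<subseteq> \<Gamma> n" if "m \<le> n" for m n using lift_Suc_mono_le[of \<Gamma>, OF \<Gamma>S that] .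
  have Nm: "N m \<le> N n" if "m \<le> n" for m n
    using lift_Suc_mono_le[of N, OF _ that] NS less_imp_le by blast
  have Nge: "n < N n" for n
  proof (induction n)
    case 0
    then show ?case using wd unfolding word_def by blast
  next
    case (Suc n)
    then show ?case using NS[of n] by simp
  qed
  have Wm: "W n \<inter> {..<N m} = W m" if "m \<le> n" for m n
    using that
  proof (induction n rule: dec_induct)
    case base
    then show ?case using wd unfolding word_def by blast
  next
    case (step n)
    have "W (Suc n) \<inter> {..<N m} = W (Suc n) \<inter> {..<N n} \<inter> {..<N m}" using Nm[OF step(1)] by auto
    then show ?case using WS step by simp
  qed
  define B where "B = (\<Union>n. W n)"
  have BW: "i \<in> B \<longleftrightarrow> i \<in> W n" if "i < N n" for i n
  proof
    assume "i \<in> B"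
    then obtain m where m: "i \<in> W m" by (auto simp: B_def)
    show "i \<in> W n"
    proof (cases "m \<le> n")
      case True
      then show ?thesis using Wm m by blast
    next
      case False
      then show ?thesis using Wm[of n m] m that by simp blast
    qed
  qed (auto simp: B_def)
  show ?thesis
  proof
    show "0 \<in> B" using wd unfolding word_def B_def by blast
    show "B \<subseteq> insert 0 C" using wd unfolding word_def B_def by blast
    fix k
    show "\<exists>G. \<forall>p. \<exists>s. p \<le> s \<and> s < p + G \<and> occurs B k B s"
    proof (rule exI[of _ "L (W k) + 2 * N k"], rule allI)
      fix p
      define n where "n = p + N k"
      have n: "k \<le> n" "p + N k \<le> N n" using Nge[of n] Nge[of k] unfolding n_def by linarith+
      have "recurs (W k) (N k) (W n) (N n)" using wd mem \<Gamma>m[OF n(1)] unfolding word_def by blast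
      then obtain s where s: "p \<le> s" "s < p + (L (W k) + 2 * N k)" "s + N k \<le> N n"
          "occurs (W k) (N k) (W n) s"
        using n(2) unfolding recurs_def hits_def by blast
      have "occurs B k B s"
        unfolding occurs_def
      proof (intro allI impI)
        fix i assume "i < k"
        then have i: "i < N k" using Nge[of k] by linarith
        have "s + i \<in> B \<longleftrightarrow> s + i \<in> W n" using BW i s(3) by simp
        also have "\<dots> \<longleftrightarrow> i \<in> W k" using s(4) i unfolding occurs_def by blast
        also have "\<dots> \<longleftrightarrow> i \<in> B" using BW[OF i] by simp
        finally show "s + i \<in> B \<longleftrightarrow> i \<in> B" .
      qed
      then show "\<exists>s. p \<le> s \<and> s < p + (L (W k) + 2 * N k) \<and> occurs B k B s" using s by blast
    qed
  qed
qed

end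

section \<open>Uniformly recurrent points\<close>

lemma mtopology_dist: "Metric_space.mtopology (X :: 'a::metric_space set) dist = top_of_set X"
proof -
  interpret Submetric UNIV dist X by unfold_locales auto
  show ?thesis using mtopology_submetric by simp
qed

text \<open>
  The points whose orbit comes close to \<open>x\<close> within the first \<open>G\<close> steps form a closed set, which
  contains the orbit of \<open>x\<close> by uniform recurrence and hence the orbit closure. So every closed
  invariant nonempty subset of the orbit closure contains points arbitrarily close to \<open>x\<close>, thus \<open>x\<close>
  itself.
\<close>

lemma minimal_orbit_closure:
  fixes T :: "'a::metric_space \<Rightarrow> 'a"
  defines "Y \<equiv> \<lambda>x. closure (range (\<lambda>n. (T ^^ n) x))"
  assumes cont: "continuous_on UNIV T" and cpt: "compact (Y x)"
    and rec: "\<And>U. open U \<Longrightarrow> x \<in> U \<Longrightarrow> \<exists>G. \<forall>p. \<exists>s. p \<le> s \<and> s < p + G \<and> (T ^^ s) x \<in> U"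
  shows "minimal_tds (Y x) dist T"
proof -
  have contn: "continuous_on UNIV (T ^^ n)" for n
    by (induction n) (auto intro!: continuous_on_compose2[OF cont] continuous_on_id simp: id_def)
  have xY: "(T ^^ n) x \<in> Y x" for n using closure_subset unfolding Y_def by fast
  have TY: "T ` Y x \<subseteq> Y x"
  proof -
    have "T ` Y x \<subseteq> closure (T ` range (\<lambda>n. (T ^^ n) x))"
      unfolding Y_def
      by (intro image_closure_subset closed_closure closure_subset continuous_on_subset[OF cont]) auto
    also have "\<dots> \<subseteq> Y x"
      unfolding Y_def
    proof (rule closure_mono, clarify)
      fix n show "T ((T ^^ n) x) \<in> range (\<lambda>n. (T ^^ n) x)" by (rule range_eqI[of _ _ "Suc n"]) simp
    qed
    finally show ?thesis .
  qed
  have min: "Z = Y x" if Z: "closedin (top_of_set (Y x)) Z" "Z \<noteq> {}" "T ` Z \<subseteq> Z" for Z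
  proof -
    have clZ: "closed Z" and ZY: "Z \<subseteq> Y x"
      using closedin_closed_trans[OF Z(1)] closedin_subset[OF Z(1)] unfolding Y_def by simp_all
    obtain z where z: "z \<in> Z" using Z(2) by blast
    have Tz: "(T ^^ n) z \<in> Z" for n by (induction n) (use z Z(3) in auto)
    have "x \<in> Z"
    proof (rule ccontr)
      assume "x \<notin> Z"
      then obtain e where e: "e > 0" "\<And>y. y \<in> Z \<Longrightarrow> e \<le> dist x y"
        using clZ openE[of "- Z" x] by (metis ComplD ComplI mem_ball not_le open_Compl subsetD)
      obtain G where G: "\<And>p. \<exists>s. p \<le> s \<and> s < p + G \<and> (T ^^ s) x \<in> ball x (e/2)"
        using rec[of "ball x (e/2)"] e(1) by auto
      define K where "K = (\<Union>s\<in>{..<G}. (T ^^ s) -` cball x (e/2))"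
      have "closed K" unfolding K_def
        by (intro closed_UN finite_lessThan ballI continuous_closed_vimage)
           (use contn in \<open>auto simp: continuous_on_eq_continuous_at\<close>)
      moreover have "(T ^^ p) x \<in> K" for p
      proof -
        obtain s where s: "p \<le> s" "s < p + G" "(T ^^ s) x \<in> ball x (e/2)" using G by blast
        have "(T ^^ (s - p)) ((T ^^ p) x) = (T ^^ s) x"
          using s(1) by (simp flip: funpow_add[unfolded o_def, THEN fun_cong])
        then show ?thesis unfolding K_def using s by (intro UN_I[of "s - p"]) auto
      qed
      ultimately have "Y x \<subseteq> K" unfolding Y_def by (intro closure_minimal) auto
      then obtain s where "dist x ((T ^^ s) z) \<le> e/2" using z ZY unfolding K_def by auto
      then show False using e(1) e(2)[OF Tz[of s]] by linarith
    qed
    then have "(T ^^ n) x \<in> Z" for n by (induction n) (use Z(3) in auto)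
    then have "Y x \<subseteq> Z" unfolding Y_def using clZ by (intro closure_minimal) auto
    then show ?thesis using ZY by blast
  qed
  have "compact_space (top_of_set (Y x))" using cpt by (simp add: compact_space_subtopology)
  moreover have "continuous_map (top_of_set (Y x)) (top_of_set (Y x)) T"
    using TY continuous_on_subset[OF cont] by (auto simp: continuous_map_subtopology_eu)
  moreover have "Metric_space (Y x) dist" using Met_TC.subspace by auto
  moreover have "Y x \<noteq> {}" using xY by blast
  ultimately show ?thesis
    unfolding minimal_tds_def tds_def mtopology_dist using min by blast
qed

lemma open_fun_determined_by_prefix:
  fixes U :: "(nat \<Rightarrow> 'a::topological_space) set"
  assumes "open U" "x \<in> U"
  obtains k where "\<And>y. (\<And>i. i < k \<Longrightarrow> y i = x i) \<Longrightarrow> y \<in> U"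
proof -
  have "openin (product_topology (\<lambda>i::nat. euclidean) UNIV) U"
    using assms(1) by (simp add: euclidean_product_topology)
  then obtain X where X: "x \<in> (\<Pi>\<^sub>E i\<in>UNIV. X i)" "finite {i. X i \<noteq> (UNIV :: 'a set)}"
      "(\<Pi>\<^sub>E i\<in>UNIV. X i) \<subseteq> U"
    using product_topology_open_contains_basis[of "\<lambda>i. euclidean" UNIV U x] assms(2)
    by auto
  obtain k where k: "\<And>i. X i \<noteq> UNIV \<Longrightarrow> i < k"
    using X(2) finite_nat_set_iff_bounded by auto
  have "y \<in> U" if y: "\<And>i. i < k \<Longrightarrow> y i = x i" for y
  proof -
    have "y i \<in> X i" for i
    proof (cases "i < k")
      case True
      then show ?thesis using y X(1) by (simp add: PiE_iff)
    next
      case False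
      then show ?thesis using k by auto
    qed
    then show ?thesis using X(3) by auto
  qed
  then show ?thesis using that by blast
qed

text \<open>
  The witness is the orbit closure of the indicator sequence of \<open>B\<close> under the shift, together with the
  neighbourhood of all sequences whose first symbol is 1.
\<close>

lemma recurrent_word_imp_dynamically_central_syndetic:
  assumes "0 \<in> B" and rec: "\<And>k. \<exists>G. \<forall>p. \<exists>s. p \<le> s \<and> s < p + G \<and> occurs B k B s"
  shows "dynamically_central_syndetic (B - {0})"
proof -
  define T where "T = (\<lambda>(w :: nat \<Rightarrow> real) i. w (Suc i))"
  define x where "x = (\<lambda>i. of_bool (i \<in> B) :: real)"
  define Y where "Y = closure (range (\<lambda>n. (T ^^ n) x))"
  have Tn: "(T ^^ n) w = (\<lambda>i. w (n + i))" for n w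
    by (induction n) (auto simp: T_def)
  have cont: "continuous_on UNIV T"
    unfolding T_def by (intro continuous_on_coordinatewise_then_product) auto
  have cc: "compact (\<Pi>\<^sub>E i\<in>(UNIV::nat set). {0, 1::real})"
    using compactin_PiE[of "\<lambda>i::nat. euclidean" UNIV "\<lambda>i. {0, 1::real}"]
    by (simp add: euclidean_product_topology)
  moreover have "range (\<lambda>n. (T ^^ n) x) \<subseteq> (\<Pi>\<^sub>E i\<in>(UNIV::nat set). {0, 1::real})"
    by (auto simp: Tn x_def)
  ultimately have "Y \<subseteq> (\<Pi>\<^sub>E i\<in>(UNIV::nat set). {0, 1::real})"
    unfolding Y_def by (intro closure_minimal compact_imp_closed)
  then have cpt: "compact Y"
    using compact_Int_closed[OF cc, of Y] by (simp add: Y_def Int_absorb1)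
  have min: "minimal_tds Y dist T"
    unfolding Y_def
  proof (rule minimal_orbit_closure[OF cont cpt[unfolded Y_def]])
    fix U assume "open U" "x \<in> U"
    then obtain k where k: "\<And>y. (\<And>i. i < k \<Longrightarrow> y i = x i) \<Longrightarrow> y \<in> U"
      using open_fun_determined_by_prefix by blast
    have "(T ^^ s) x \<in> U" if "occurs B k B s" for s
      using that by (intro k) (simp add: Tn x_def occurs_def)
    then show "\<exists>G. \<forall>p. \<exists>s. p \<le> s \<and> s < p + G \<and> (T ^^ s) x \<in> U" using rec[of k] by meson
  qed
  define U where "U = Y \<inter> {w. w 0 > 1/2}"
  have "x \<in> range (\<lambda>n. (T ^^ n) x)" by (rule range_eqI[of _ _ 0]) simp
  then have xY: "x \<in> Y" unfolding Y_def by (rule subsetD[OF closure_subset])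
  have "open {w :: nat \<Rightarrow> real. w 0 > 1/2}"
    by (intro open_Collect_less continuous_on_const continuous_on_product_coordinates)
  then have oU: "openin (Metric_space.mtopology Y dist) U"
    unfolding U_def mtopology_dist by (simp add: openin_open_Int)
  have "return_times T x U \<subseteq> B - {0}"
    by (auto simp: return_times_def U_def Tn x_def split: if_splits)
  moreover have "x \<in> U" using assms(1) xY by (simp add: U_def x_def)
  ultimately show ?thesis using dynamically_central_syndeticI[OF min xY oU] by blast
qed

lemma dynamically_central_syndetic_mono:
  "dynamically_central_syndetic A \<Longrightarrow> A \<subseteq> B \<Longrightarrow> dynamically_central_syndetic B"
  unfolding dynamically_central_syndetic_def by (meson order_trans)

lemma dynamically_syndetic_mono:
  "dynamically_syndetic A \<Longrightarrow> A \<subseteq> B \<Longrightarrow> dynamically_syndetic B"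
  unfolding dynamically_syndetic_def by (meson order_trans)

text \<open>
  The hypothesis is a purely combinatorial form of being a set of return times of a uniformly
  recurrent point to a neighbourhood: if \<open>C = R(x, U)\<close>, then \<open>{n. n + V \<subseteq> C}\<close> contains the returns
  of \<open>x\<close> to another neighbourhood of \<open>x\<close>. Unlike being of the form
  \<open>R(x, U)\<close>, it visibly survives the removal of a set that is not piecewise syndetic.
\<close>

lemma dynamically_central_syndetic_if_syndetic_translates:
  assumes "\<And>V. finite V \<Longrightarrow> V \<subseteq> insert 0 C \<Longrightarrow> \<exists>G. \<forall>a. \<exists>n. a \<le> n \<and> n < a + G \<and> (+) n ` V \<subseteq> C"
  shows "dynamically_central_syndetic C"
proof -
  have "\<exists>G. finite V \<and> V \<subseteq> insert 0 C \<longrightarrow> (\<forall>a. \<exists>n. a \<le> n \<and> n < a + G \<and> (+) n ` V \<subseteq> C)" for V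
    using assms[of V] by auto
  then have "\<forall>V. \<exists>G. finite V \<and> V \<subseteq> insert 0 C \<longrightarrow> (\<forall>a. \<exists>n. a \<le> n \<and> n < a + G \<and> (+) n ` V \<subseteq> C)"
    by (rule allI)
  from choice[OF this] obtain L where "\<forall>V. finite V \<and> V \<subseteq> insert 0 C \<longrightarrow>
      (\<forall>a. \<exists>n. a \<le> n \<and> n < a + L V \<and> (+) n ` V \<subseteq> C)" ..
  then interpret tiling C L by unfold_locales blast
  obtain B where "0 \<in> B" "B \<subseteq> insert 0 C"
    and "\<And>k. \<exists>G. \<forall>p. \<exists>s. p \<le> s \<and> s < p + G \<and> occurs B k B s"
    using uniformly_recurrent_subset by blast
  then have "dynamically_central_syndetic (B - {0})" "B - {0} \<subseteq> C"
    using recurrent_word_imp_dynamically_central_syndetic by auto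
  then show ?thesis using dynamically_central_syndetic_mono by blast
qed

section \<open>Return times in minimal systems\<close>

lemma minimal_tdsD:
  assumes "minimal_tds X d T"
  shows "topspace (Metric_space.mtopology X d) = X"
    and "continuous_map (Metric_space.mtopology X d) (Metric_space.mtopology X d) (T ^^ n)"
    and "x \<in> X \<Longrightarrow> (T ^^ n) x \<in> X"
    and "Hausdorff_space (Metric_space.mtopology X d)"
    and "compact_space (Metric_space.mtopology X d)"
proof -
  interpret Metric_space X d using assms by (simp add: minimal_tds_def tds_def)
  show "topspace mtopology = X" by simp
  show "Hausdorff_space mtopology" by (rule Hausdorff_space_mtopology)
  show "compact_space mtopology" using assms by (simp add: minimal_tds_def tds_def)
  have T: "continuous_map mtopology mtopology T" using assms by (simp add: minimal_tds_def tds_def)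
  have C: "continuous_map mtopology mtopology (T ^^ n)" for n
  proof (induction n)
    case 0
    then show ?case by (simp add: id_def)
  next
    case (Suc n)
    then show ?case using continuous_map_compose[OF Suc T] by (simp add: o_def)
  qed
  show "continuous_map mtopology mtopology (T ^^ n)" by (rule C)
  show "x \<in> X \<Longrightarrow> (T ^^ n) x \<in> X"
    using continuous_map_image_subset_topspace[OF C[of n]] by auto
qed

lemma minimal_tds_closed_invariant:
  "minimal_tds X d T \<Longrightarrow> closedin (Metric_space.mtopology X d) Z \<Longrightarrow> Z \<noteq> {} \<Longrightarrow> T ` Z \<subseteq> Z \<Longrightarrow> Z = X"
  by (simp add: minimal_tds_def)

lemma minimal_surj:
  assumes min: "minimal_tds X d T"
  shows "(T ^^ n) ` X = X"
proof -
  let ?M = "Metric_space.mtopology X d"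
  note D = minimal_tdsD[OF min]
  have "T ` X = X"
  proof (rule minimal_tds_closed_invariant[OF min])
    have "compactin ?M (T ` X)"
      using image_compactin[of ?M X ?M T] D(2)[of 1] D(1,5) by (simp add: compact_space_def)
    then show "closedin ?M (T ` X)" using D(4) compactin_imp_closedin by blast
    show "T ` X \<noteq> {}" using min by (simp add: minimal_tds_def tds_def)
    show "T ` T ` X \<subseteq> T ` X" using D(3)[of _ 1] by auto
  qed
  moreover have "(T ^^ Suc n) ` X = T ` (T ^^ n) ` X" for n by (simp add: image_image)
  ultimately show ?thesis by (induction n) (simp_all del: funpow.simps)
qed

text \<open>
  The points that never visit \<open>U\<close> form a closed invariant set other than \<open>X\<close>, so there are none, and
  by compactness the time until the first visit is bounded on \<open>X\<close>.
\<close>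

lemma minimal_return_times_gap:
  assumes min: "minimal_tds X d T" and x: "x \<in> X"
    and U: "openin (Metric_space.mtopology X d) U" "U \<noteq> {}"
  shows "\<exists>G. \<forall>a. \<exists>n. a \<le> n \<and> n < a + G \<and> (T ^^ n) x \<in> U"
proof -
  let ?M = "Metric_space.mtopology X d"
  note D = minimal_tdsD[OF min]
  define P where "P n = {y \<in> X. (T ^^ n) y \<in> U}" for n
  have oP: "openin ?M (P n)" for n
    using openin_continuous_map_preimage[OF D(2) U(1), of n] D(1) by (simp add: P_def)
  have "X \<subseteq> (\<Union>n. P n)"
  proof (rule ccontr)
    assume ne: "\<not> X \<subseteq> (\<Union>n. P n)"
    define Z where "Z = X - (\<Union>n. P n)"
    have "closedin ?M Z"
      using D(1) oP unfolding Z_def by (metis closedin_diff closedin_topspace openin_Union rangeE)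
    moreover have "T ` Z \<subseteq> Z"
    proof clarify
      fix z assume z: "z \<in> Z"
      then have "z \<in> X" and "(T ^^ Suc n) z \<notin> U" for n unfolding Z_def P_def by blast+
      moreover have "(T ^^ Suc n) z = (T ^^ n) (T z)" for n by (simp add: funpow_swap1)
      ultimately show "T z \<in> Z" using D(3)[of z 1] by (simp add: Z_def P_def)
    qed
    ultimately have "Z = X" using minimal_tds_closed_invariant[OF min] ne Z_def by blast
    moreover have "P 0 \<noteq> {}" using U openin_mtopology_subset[OF min] by (auto simp: P_def)
    moreover have "P 0 \<subseteq> X" by (auto simp: P_def)
    ultimately show False unfolding Z_def by blast
  qed
  then obtain F where F: "finite F" "F \<subseteq> range P" "X \<subseteq> \<Union>F"
    using D(1,5) oP unfolding compact_space_alt by (metis (no_types, lifting) rangeE)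
  then obtain I where I: "finite I" "F = P ` I" by (meson finite_subset_image)
  then obtain G where G: "I \<subseteq> {..<G}" using finite_nat_bounded by blast
  have "\<exists>n. a \<le> n \<and> n < a + G \<and> (T ^^ n) x \<in> U" for a
  proof -
    obtain i where i: "i \<in> I" "(T ^^ i) ((T ^^ a) x) \<in> U"
      using F(3) I(2) D(3)[OF x, of a] by (auto simp: P_def)
    then have "(T ^^ (a + i)) x \<in> U" by (simp add: funpow_add add.commute[of a])
    then show ?thesis using i(1) G by (intro exI[of _ "a + i"]) auto
  qed
  then show ?thesis by blast
qed

section \<open>Removing a set that is not piecewise syndetic\<close>

text \<open>
  The union of \<open>E\<close> and its translates \<open>E - 1, \<dots>, E - (N + 1)\<close> misses a point of every translate of some
  finite set \<open>F\<close>; such a point is the start of a window that avoids \<open>E\<close>.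
\<close>

lemma not_piecewise_syndetic_free_windows:
  assumes "\<not> piecewise_syndetic E"
  shows "\<exists>G. \<forall>a. \<exists>q. a \<le> q \<and> q < a + G \<and> {q..q + N} \<inter> E = {}"
proof -
  have "\<not> thick (E \<union> (\<Union>n\<in>{1..Suc N}. pshift E n))"
    using assms unfolding piecewise_syndetic_def by (metis le_add1 plus_1_eq_Suc)
  then obtain F where F: "finite F" "F \<subseteq> {1..}"
    and no: "\<And>n. 1 \<le> n \<Longrightarrow> \<not> (\<lambda>m. m + n) ` F \<subseteq> E \<union> (\<Union>n\<in>{1..Suc N}. pshift E n)"
    unfolding thick_def by blast
  obtain k where k: "F \<subseteq> {..<k}" using F(1) finite_nat_bounded by blast
  have "\<exists>q. a \<le> q \<and> q < a + (k + 1) \<and> {q..q + N} \<inter> E = {}" for a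
  proof -
    obtain m where m: "m \<in> F" "m + Suc a \<notin> E \<union> (\<Union>n\<in>{1..Suc N}. pshift E n)"
      using no[of "Suc a"] by auto
    have "i \<notin> E" if i: "m + Suc a \<le> i" "i \<le> m + Suc a + N" for i
    proof (cases "i = m + Suc a")
      case False
      then have "i - (m + Suc a) \<in> {1..Suc N}" using i by auto
      then have "m + Suc a \<notin> pshift E (i - (m + Suc a))" using m(2) by blast
      then show ?thesis using i by (simp add: pshift_def)
    qed (use m in auto)
    then show ?thesis using m(1) k by (intro exI[of _ "m + Suc a"]) auto
  qed
  then show ?thesis by blast
qed

text \<open>
  Every window of length \<open>L\<close> contains a number satisfying \<open>P\<close>; take a window that avoids \<open>E\<close> and is
  longer by \<open>K\<close>.
\<close>

lemma syndetic_avoiding_translates: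
  assumes S: "\<And>a. \<exists>n. a \<le> n \<and> n < a + (L::nat) \<and> P n" and E: "\<not> piecewise_syndetic E"
  shows "\<exists>G. \<forall>a. \<exists>n. a \<le> n \<and> n < a + G \<and> P n \<and> (\<forall>f\<le>K. n + f \<notin> E)"
proof -
  obtain G where G: "\<And>a. \<exists>q. a \<le> q \<and> q < a + G \<and> {q..q + (L + K)} \<inter> E = {}"
    using not_piecewise_syndetic_free_windows[OF E] by blast
  have "\<exists>n. a \<le> n \<and> n < a + (G + L) \<and> P n \<and> (\<forall>f\<le>K. n + f \<notin> E)" for a
  proof -
    obtain q where q: "a \<le> q" "q < a + G" "{q..q + (L + K)} \<inter> E = {}" using G by blast
    obtain n where n: "q \<le> n" "n < q + L" "P n" using S by blast
    have "n + f \<notin> E" if "f \<le> K" for f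
    proof -
      have "n + f \<in> {q..q + (L + K)}" using that n by auto
      then show ?thesis using q(3) by blast
    qed
    then show ?thesis using q n by (intro exI[of _ n]) auto
  qed
  then show ?thesis by blast
qed

text \<open>
  The positions where a finite \<open>V\<close> fits are the returns of \<open>x\<close> to the neighbourhood
  \<open>\<Inter>f\<in>V \<union> {0}. T\<^sup>-\<^sup>f U\<close> of \<open>x\<close>, apart from those excluded by \<open>E\<close> and by \<open>c\<close>. The parameter \<open>c\<close> prepares
  the translation by \<open>c\<close> in \<open>dynamically_syndetic_shift\<close>; for a dynamically central syndetic set
  it is 0.
\<close>

lemma dynamically_central_syndetic_diff:
  assumes min: "minimal_tds X d T" and x: "x \<in> X"
    and U: "openin (Metric_space.mtopology X d) U" "x \<in> U"
    and E: "\<not> piecewise_syndetic E"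
  shows "dynamically_central_syndetic {m. c < m \<and> (T ^^ m) x \<in> U \<and> m + c \<notin> E}"
    (is "dynamically_central_syndetic ?C")
proof (rule dynamically_central_syndetic_if_syndetic_translates)
  let ?M = "Metric_space.mtopology X d"
  note D = minimal_tdsD[OF min]
  fix V assume V: "finite V" "V \<subseteq> insert 0 ?C"
  define UV where "UV = U \<inter> (\<Inter>f\<in>V. {y \<in> X. (T ^^ f) y \<in> U})"
  have "openin ?M UV"
  proof (cases "V = {}")
    case True
    then show ?thesis using U by (simp add: UV_def)
  next
    case False
    have "openin ?M {y \<in> X. (T ^^ f) y \<in> U}" for f
      using openin_continuous_map_preimage[OF D(2) U(1), of f] D(1) by simp
    then show ?thesis unfolding UV_def using V(1) False U(1) by (intro openin_Int openin_INT2) auto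
  qed
  moreover have "x \<in> UV" using V(2) U x by (auto simp: UV_def)
  ultimately obtain L where L: "\<And>a. \<exists>n. a \<le> n \<and> n < a + L \<and> (T ^^ n) x \<in> UV"
    using minimal_return_times_gap[OF min x] by blast
  obtain k where k: "V \<subseteq> {..<k}" using V(1) finite_nat_bounded by blast
  obtain G where G: "\<And>a. \<exists>n. a \<le> n \<and> n < a + G \<and> (T ^^ n) x \<in> UV \<and> (\<forall>f\<le>k + c. n + f \<notin> E)"
    using syndetic_avoiding_translates[OF L E] by blast
  have "\<exists>n. a \<le> n \<and> n < a + (Suc c + G) \<and> (+) n ` V \<subseteq> ?C" for a
  proof -
    obtain n where n: "a + Suc c \<le> n" "n < a + Suc c + G" "(T ^^ n) x \<in> UV" "\<forall>f\<le>k + c. n + f \<notin> E"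
      using G by blast
    have "n + f \<in> ?C" if "f \<in> V" for f
    proof -
      have "f + c \<le> k + c" using k that by auto
      then have "n + f + c \<notin> E" using n(4) by (metis add.assoc)
      moreover have "(T ^^ (n + f)) x \<in> U"
        using n(3) that by (simp add: UV_def funpow_add add.commute[of n])
      ultimately show ?thesis using n(1) by simp
    qed
    then show ?thesis using n by (intro exI[of _ n]) auto
  qed
  then show "\<exists>G. \<forall>a. \<exists>n. a \<le> n \<and> n < a + G \<and> (+) n ` V \<subseteq> ?C" by blast
qed

text \<open>
  Let \<open>C\<close> contain the returns of \<open>y\<close> to \<open>V\<close>, and let \<open>T\<^sup>n z = y\<close>. From time \<open>n\<close> on, the visits of \<open>z\<close>
  to \<open>V\<close> are as desired, but there may be unwanted ones before. As \<open>y\<close> does not return to \<open>V\<close> up to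
  time \<open>n\<close>, removing from \<open>V\<close> the points that reach \<open>y\<close> in 1 to \<open>n\<close> steps keeps \<open>y\<close>, and it
  eliminates the early visits of \<open>z\<close>, since \<open>z\<close> reaches \<open>y\<close> at time \<open>n\<close>.
\<close>

lemma dynamically_syndetic_shift:
  assumes C: "dynamically_central_syndetic C" and Cn: "C \<subseteq> {n<..}" and n: "1 \<le> n"
  shows "dynamically_syndetic (insert n ((+) n ` C))"
proof -
  obtain X :: "(nat \<Rightarrow> real) set" and d T y V where min: "minimal_tds X d T" and y: "y \<in> X"
    and V: "openin (Metric_space.mtopology X d) V" "y \<in> V" and ret: "return_times T y V \<subseteq> C"
    using C unfolding dynamically_central_syndetic_def by blast
  let ?M = "Metric_space.mtopology X d"
  note D = minimal_tdsD[OF min]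
  define V' where "V' = V - (\<Union>i\<in>{1..n}. {v \<in> X. (T ^^ i) v \<in> {y}})"
  have "closedin ?M {y}" using D(1,4) y closedin_Hausdorff_singleton by metis
  then have "closedin ?M {v \<in> X. (T ^^ i) v \<in> {y}}" for i
    using closedin_continuous_map_preimage[OF D(2), of "{y}" i] D(1) by simp
  then have oV': "openin ?M V'" unfolding V'_def using V(1) by (intro openin_diff closedin_Union) auto
  have "(T ^^ i) y \<noteq> y" if "i \<in> {1..n}" for i
  proof
    assume "(T ^^ i) y = y"
    then have "i \<in> C" using ret V(2) that by (auto simp: return_times_def)
    then show False using Cn that by auto
  qed
  then have yV': "y \<in> V'" using V(2) by (auto simp: V'_def)
  have "y \<in> (T ^^ n) ` X" using minimal_surj[OF min, of n] y by simp
  then obtain z where z: "z \<in> X" "(T ^^ n) z = y" by (elim imageE) simp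
  have "return_times T z V' \<subseteq> insert n ((+) n ` C)"
  proof
    fix m assume "m \<in> return_times T z V'"
    then have m: "1 \<le> m" "(T ^^ m) z \<in> V'" by (auto simp: return_times_def)
    have "n \<le> m"
    proof (rule ccontr)
      assume "\<not> n \<le> m"
      then have "(T ^^ (n - m)) ((T ^^ m) z) = y" "n - m \<in> {1..n}"
        using z(2) m(1) by (simp_all flip: funpow_add[unfolded o_def, THEN fun_cong])
      then show False using m(2) D(3)[OF z(1)] by (auto simp: V'_def)
    qed
    then have "(T ^^ (m - n)) y \<in> V"
      using m(2) z(2) by (auto simp: V'_def simp flip: funpow_add[unfolded o_def, THEN fun_cong])
    then have "m - n = 0 \<or> m - n \<in> C"
      using subsetD[OF ret, of "m - n"] by (cases "n < m") (auto simp: return_times_def Suc_le_eq)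
    then show "m \<in> insert n ((+) n ` C)"
      using \<open>n \<le> m\<close> by (auto intro: image_eqI[of _ _ "m - n"])
  qed
  then show ?thesis using dynamically_syndeticI[OF min z(1) oV'] yV' by blast
qed

lemma dynamically_central_syndetic_diff_not_piecewise_syndetic:
  assumes "dynamically_central_syndetic A" "\<not> piecewise_syndetic E"
  shows "dynamically_central_syndetic (A - E)"
proof -
  obtain X :: "(nat \<Rightarrow> real) set" and d T x U where min: "minimal_tds X d T" and x: "x \<in> X"
    and U: "openin (Metric_space.mtopology X d) U" "x \<in> U" and ret: "return_times T x U \<subseteq> A"
    using assms(1) unfolding dynamically_central_syndetic_def by blast
  have "dynamically_central_syndetic {m. 0 < m \<and> (T ^^ m) x \<in> U \<and> m + 0 \<notin> E}"
    by (rule dynamically_central_syndetic_diff[OF min x U assms(2)])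
  then show ?thesis
    by (rule dynamically_central_syndetic_mono) (use ret in \<open>auto simp: return_times_def\<close>)
qed

lemma dynamically_syndetic_diff_not_piecewise_syndetic:
  assumes "dynamically_syndetic A" and E: "\<not> piecewise_syndetic E"
  shows "dynamically_syndetic (A - E)"
proof -
  obtain X :: "(nat \<Rightarrow> real) set" and d T x U where min: "minimal_tds X d T" and x: "x \<in> X"
    and U: "openin (Metric_space.mtopology X d) U" "U \<noteq> {}" and ret: "return_times T x U \<subseteq> A"
    using assms(1) unfolding dynamically_syndetic_def by blast
  \<comment> \<open>The time \<open>n\<close> itself stays in the translated set, so it has to avoid \<open>E\<close>.\<close>
  obtain L where "\<And>a. \<exists>n. a \<le> n \<and> n < a + L \<and> (T ^^ n) x \<in> U"
    using minimal_return_times_gap[OF min x U] by blast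
  from syndetic_avoiding_translates[OF this E, of 0]
  obtain n where n: "1 \<le> n" "(T ^^ n) x \<in> U" "n \<notin> E" by (metis add.right_neutral le_refl)
  define C where "C = {m. n < m \<and> (T ^^ m) ((T ^^ n) x) \<in> U \<and> m + n \<notin> E}"
  have "dynamically_central_syndetic C"
    unfolding C_def
    using dynamically_central_syndetic_diff[OF min minimal_tdsD(3)[OF min x] U(1) n(2) E] .
  then have "dynamically_syndetic (insert n ((+) n ` C))"
    by (rule dynamically_syndetic_shift) (use n in \<open>auto simp: C_def\<close>)
  moreover have "insert n ((+) n ` C) \<subseteq> A - E"
  proof -
    have "n + m \<in> A - E" if "m \<in> C" for m
    proof -
      have "(T ^^ (n + m)) x \<in> U" "n + m \<notin> E"
        using that by (auto simp: C_def funpow_add add.commute[of n])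
      then show ?thesis using ret n(1) by (auto simp: return_times_def)
    qed
    moreover have "n \<in> A - E" using n ret by (auto simp: return_times_def)
    ultimately show ?thesis by blast
  qed
  ultimately show ?thesis by (rule dynamically_syndetic_mono)
qed

section \<open>Duality and the theorem\<close>

lemma pointwise_recurrence_set_iff:
  assumes "A \<subseteq> {1..}"
  shows "pointwise_recurrence_set A \<longleftrightarrow> \<not> dynamically_central_syndetic ({1..} - A)"
proof -
  have "(\<exists>n\<in>A. (T ^^ n) x \<in> U) \<longleftrightarrow> \<not> return_times T x U \<subseteq> {1..} - A"
    for T and x :: "nat \<Rightarrow> real" and U
    using assms by (auto simp: return_times_def)
  then show ?thesis
    unfolding pointwise_recurrence_set_def dynamically_central_syndetic_def by blast
qed

lemma dynamically_thick_iff: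
  assumes "A \<subseteq> {1..}"
  shows "dynamically_thick A \<longleftrightarrow> \<not> dynamically_syndetic ({1..} - A)"
proof -
  have "(\<exists>n\<in>A. (T ^^ n) x \<in> U) \<longleftrightarrow> \<not> return_times T x U \<subseteq> {1..} - A"
    for T and x :: "nat \<Rightarrow> real" and U
    using assms by (auto simp: return_times_def)
  then show ?thesis
    unfolding dynamically_thick_def dynamically_syndetic_def by blast
qed

lemma syndetic_notions_cong:
  assumes "\<not> piecewise_syndetic (sym_diff A B)"
  shows "dynamically_syndetic A \<longleftrightarrow> dynamically_syndetic B"
    and "dynamically_central_syndetic A \<longleftrightarrow> dynamically_central_syndetic B"
proof -
  have sub: "A - sym_diff A B \<subseteq> B" "B - sym_diff A B \<subseteq> A" by auto
  show "dynamically_syndetic A \<longleftrightarrow> dynamically_syndetic B"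
    using dynamically_syndetic_diff_not_piecewise_syndetic[OF _ assms]
      dynamically_syndetic_mono sub by blast
  show "dynamically_central_syndetic A \<longleftrightarrow> dynamically_central_syndetic B"
    using dynamically_central_syndetic_diff_not_piecewise_syndetic[OF _ assms]
      dynamically_central_syndetic_mono sub by blast
qed

theorem theoremG:
  fixes A B :: "nat set"
  assumes "A \<subseteq> {1..}" and "B \<subseteq> {1..}"
    and "\<not> piecewise_syndetic (sym_diff A B)"
  shows "(pointwise_recurrence_set A \<longleftrightarrow> pointwise_recurrence_set B) \<and>
         (dynamically_thick A \<longleftrightarrow> dynamically_thick B) \<and>
         (dynamically_syndetic A \<longleftrightarrow> dynamically_syndetic B) \<and>
         (dynamically_central_syndetic A \<longleftrightarrow> dynamically_central_syndetic B)"
proof -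
  have "sym_diff ({1..} - A) ({1..} - B) = sym_diff A B" using assms(1,2) by auto
  then have "\<not> piecewise_syndetic (sym_diff ({1..} - A) ({1..} - B))" using assms(3) by simp
  note compl = syndetic_notions_cong[OF this]
  show ?thesis
    using syndetic_notions_cong[OF assms(3)] compl
      pointwise_recurrence_set_iff[OF assms(1)] pointwise_recurrence_set_iff[OF assms(2)]
      dynamically_thick_iff[OF assms(1)] dynamically_thick_iff[OF assms(2)] by blast
qed

end
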